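(* Let $X$ be a real normed space, let $L\subset X$ be a nontrivial locally compact cone, let $g:X\to\mathbb R$ be $L_g$-Lipschitz continuous with $L_g>0$, let $(P)$ denote the problem $\inf\{g(x):x\in L\}$ and let $v:=\inf_{x\in L}g(x)$. Let $\eta_n\in(0,1)$ with $\eta_n\downarrow0$ and, for each $n$, let $(D_L^{\eta_n},\Phi_{\eta_n})$ be an admissible pair for $L$, $g$ at scale $\eta_n$ (as defined in the context). Fix $M>L_g$ and suppose that, for each $n$, the penalized problem \[ (P_{\eta_n})\qquad \inf_{x\in X}\bigl\{g(x)+M[-\Phi_{\eta_n}(x)]_+\bigr\} \] has a solution $x_n$, with $\sup_n\|x_n\|\le R$ for some $R>0$. Set $v_n:=\min(P_{\eta_n})$. Then there exist $l_n\in L$ such that \[ \|x_n-l_n\|\to0,\qquad g(l_n)\to v,\qquad v_n\to v. \] Moreover, $(x_n)$ and $(l_n)$ are relatively compact, $(P)$ has a solution, and every cluster point of either sequence belongs to $\operatorname{argmin}_{x\in L}g(x)$. In particular, if $(P)$ has a unique solution $\bar l$, then $x_n\to\bar l$ and $l_n\to\bar l$.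
   Context: $S_X$, $B_X$ are the unit sphere and closed unit ball, $\operatorname{cone}(A)=\{ta:t\ge0,\ a\in A\}$, $[t]_+=\max\{t,0\}$. A nonempty set $C\subset X$ is a cone if $tC\subset C$ for every $t\ge 0$; all cones are assumed proper, i.e. $\{0_X\}\subsetneq C\subsetneq X$ (not necessarily convex). A cone $L$ is locally compact if for every $x\in L$ there is $r>0$ with $L\cap\{y:\|y-x\|\le r\}$ norm compact. $B_L:=L\cap S_X$, $L_\eta:=\operatorname{cone}(B_L+\eta B_X)$. For $u\in S_X$, $f\in S_{X^*}$ with $f(u)=1$ and $\delta>0$, the uniform axial deviation cone is $C^{\rm ax}(u,f,\delta):=\{x\in X:f(x)-\delta^{-1}\|x-f(x)u\|\ge0\}$. For $\eta\in(0,1)$, a pair $(D_L^\eta,\Phi_\eta)$ is called admissible for $L,g$ at scale $\eta$ if: $D_L^\eta=\bigcup_{i=1}^mC_i$ is a closed cone that is a finite union of uniform axial deviation cones with $L\setminus\{0_X\}\subset\bigcup_i\operatorname{int}C_i$ and $L\subset D_L^\eta\subset L_\eta$; $\Phi_\eta:X\to\mathbb R$ is continuous and positively homogeneous with $D_L^\eta=\{\Phi_\eta\ge0\}$; for every $M>L_g$ the problem $(P_\eta)$: $\inf_{x\in X}\{g(x)+M[-\Phi_\eta(x)]_+\}$ satisfies $\inf(P_\eta)=\inf_{D_L^\eta}g$ and all its solutions lie in $D_L^\eta$; and whenever $(P_\eta)$ has a solution $x_\eta$ with $\|x_\eta\|\le R$ for some $R>0$, then, with $v=\inf_Lg$ and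 $v_\eta=\min(P_\eta)$, one has $v\in\mathbb R$ and there is $l_\eta\in L$ with $\|x_\eta-l_\eta\|\le\eta\|x_\eta\|\le R\eta$, $0\le g(l_\eta)-v\le L_g\eta\|x_\eta\|\le L_gR\eta$ and $0\le v-v_\eta\le L_g\eta\|x_\eta\|\le L_gR\eta$. (Such pairs exist for every $\eta\in(0,1)$.) A solution of a minimization problem is a feasible point at which the infimum is attained. *)

theory Defs
  imports "HOL-Analysis.Analysis"
begin

definition proper_cone :: "'a::real_normed_vector set \<Rightarrow> bool" where
  "proper_cone C \<longleftrightarrow> cone C \<and> {0} \<subset> C \<and> C \<subset> UNIV"

definition locally_compact_cone :: "'a::real_normed_vector set \<Rightarrow> bool" where
  "locally_compact_cone L \<longleftrightarrow>
     proper_cone L \<and> (\<forall>x\<in>L. \<exists>r>0. compact (L \<inter> cball x r))"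

definition generated_cone :: "'a::real_normed_vector set \<Rightarrow> 'a set" where
  "generated_cone A = {t *\<^sub>R a | t a. 0 \<le> t \<and> a \<in> A}"

definition cone_base :: "'a::real_normed_vector set \<Rightarrow> 'a set" where
  "cone_base L = L \<inter> sphere 0 1"

definition cone_enlargement :: "real \<Rightarrow> 'a::real_normed_vector set \<Rightarrow> 'a set" where
  "cone_enlargement \<eta> L =
     generated_cone {b + \<eta> *\<^sub>R y | b y. b \<in> cone_base L \<and> y \<in> cball 0 1}"

definition axial_cone :: "'a::real_normed_vector \<Rightarrow> ('a \<Rightarrow>\<^sub>L real) \<Rightarrow> real \<Rightarrow> 'a set" where
  "axial_cone u f \<delta> =
     {x. blinfun_apply f x - inverse \<delta> * norm (x - blinfun_apply f x *\<^sub>R u) \<ge> 0}"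

text \<open>Infima are taken in the extended reals, since problems may be unbounded below.\<close>

definition inf_val :: "'a set \<Rightarrow> ('a \<Rightarrow> real) \<Rightarrow> ereal" where
  "inf_val A h = (INF x\<in>A. ereal (h x))"

definition argmin_on :: "'a set \<Rightarrow> ('a \<Rightarrow> real) \<Rightarrow> 'a set" where
  "argmin_on A h = {x \<in> A. ereal (h x) = inf_val A h}"

definition penalized ::
  "('a \<Rightarrow> real) \<Rightarrow> real \<Rightarrow> ('a \<Rightarrow> real) \<Rightarrow> 'a \<Rightarrow> real" where
  "penalized g M \<Phi> x = g x + M * max (- \<Phi> x) 0"

definition axial_cover :: "'a::real_normed_vector set \<Rightarrow> 'a set \<Rightarrow> bool" where
  "axial_cover L D \<longleftrightarrow>
     (\<exists>(m::nat) u f \<delta>.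
        (\<forall>i<m. norm (u i) = 1 \<and> norm (f i) = 1 \<and> blinfun_apply (f i) (u i) = 1 \<and> \<delta> i > 0) \<and>
        D = (\<Union>i<m. axial_cone (u i) (f i) (\<delta> i)) \<and>
        L - {0} \<subseteq> (\<Union>i<m. interior (axial_cone (u i) (f i) (\<delta> i))))"

definition exact_penalty ::
  "('a \<Rightarrow> real) \<Rightarrow> real \<Rightarrow> 'a set \<Rightarrow> ('a \<Rightarrow> real) \<Rightarrow> bool" where
  "exact_penalty g M D \<Phi> \<longleftrightarrow>
     inf_val UNIV (penalized g M \<Phi>) = inf_val D g \<and>
     argmin_on UNIV (penalized g M \<Phi>) \<subseteq> D"

text \<open>Here \<open>v\<close> is the infimum of \<open>g\<close> over \<open>L\<close>, whose finiteness is part of the assertion,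
  and \<open>w\<close> is the minimum of the penalized problem, finite because it is attained at \<open>x\<close>.\<close>

definition penalty_estimates ::
  "'a::real_normed_vector set \<Rightarrow> ('a \<Rightarrow> real) \<Rightarrow> real \<Rightarrow> real \<Rightarrow> real \<Rightarrow> ('a \<Rightarrow> real) \<Rightarrow> bool" where
  "penalty_estimates L g Lg \<eta> M \<Phi> \<longleftrightarrow>
     (\<forall>R>0. \<forall>x \<in> argmin_on UNIV (penalized g M \<Phi>). norm x \<le> R \<longrightarrow>
        (\<exists>v w. inf_val L g = ereal v \<and> inf_val UNIV (penalized g M \<Phi>) = ereal w \<and>
          (\<exists>l\<in>L.
             norm (x - l) \<le> \<eta> * norm x \<and> \<eta> * norm x \<le> R * \<eta> \<and>
             0 \<le> g l - v \<and> g l - v \<le> Lg * \<eta> * norm x \<and> Lg * \<eta> * norm x \<le> Lg * R * \<eta> \<and>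
             0 \<le> v - w \<and> v - w \<le> Lg * \<eta> * norm x)))"

definition admissible ::
  "'a::real_normed_vector set \<Rightarrow> ('a \<Rightarrow> real) \<Rightarrow> real \<Rightarrow> real \<Rightarrow> 'a set \<Rightarrow> ('a \<Rightarrow> real) \<Rightarrow> bool" where
  "admissible L g Lg \<eta> D \<Phi> \<longleftrightarrow>
     closed D \<and> proper_cone D \<and> axial_cover L D \<and>
     L \<subseteq> D \<and> D \<subseteq> cone_enlargement \<eta> L \<and>
     continuous_on UNIV \<Phi> \<and> (\<forall>t\<ge>0. \<forall>x. \<Phi> (t *\<^sub>R x) = t * \<Phi> x) \<and>
     D = {x. \<Phi> x \<ge> 0} \<and>
     (\<forall>M>Lg. exact_penalty g M D \<Phi> \<and> penalty_estimates L g Lg \<eta> M \<Phi>)"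

definition seq_cluster_point :: "(nat \<Rightarrow> 'a::metric_space) \<Rightarrow> 'a \<Rightarrow> bool" where
  "seq_cluster_point s p \<longleftrightarrow> (\<exists>r. strict_mono r \<and> (s \<circ> r) \<longlonglongrightarrow> p)"

definition relatively_compact_seq :: "(nat \<Rightarrow> 'a::metric_space) \<Rightarrow> bool" where
  "relatively_compact_seq s \<longleftrightarrow> compact (closure (range s))"

end

theory Submission
  imports Defs
begin

text \<open>A cone that is locally compact at the origin meets every ball in a compact set, by scaling.
  The points \<open>l\<^sub>n\<close> given by the admissibility estimates are bounded, so they stay in such a
  compact set; since \<open>x\<^sub>n - l\<^sub>n\<close> tends to zero, \<open>x\<^sub>n\<close> inherits relative compactness (without
  completeness of the space) and the cluster points of \<open>l\<^sub>n\<close>.\<close>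

lemma cone_inter_cball_compact:
  fixes L :: "'a::real_normed_vector set"
  assumes "locally_compact_cone L"
  shows "compact (L \<inter> cball 0 s)"
proof -
  have cn: "cone L" and "0 \<in> L"
    using assms by (auto simp: locally_compact_cone_def proper_cone_def)
  then obtain r where r: "r > 0" "compact (L \<inter> cball 0 r)"
    using assms by (auto simp: locally_compact_cone_def)
  \<comment> \<open>The maximum keeps \<open>c\<close> positive for every real \<open>s\<close>, and
    makes the dilated ball of radius \<open>c * r\<close> contain \<open>cball 0 s\<close>.\<close>
  define c where "c = max s r / r"
  have c: "c > 0" "c * r = max s r"
    using r by (auto simp: c_def)
  have "L \<inter> cball 0 s \<subseteq> (\<lambda>x. c *\<^sub>R x) ` (L \<inter> cball 0 r)"
  proof
    fix x assume x: "x \<in> L \<inter> cball 0 s"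
    have "norm x \<le> c * r"
      using x c by auto
    then have "inverse c *\<^sub>R x \<in> L \<inter> cball 0 r"
      using x c cn by (auto simp: cone_def field_simps)
    moreover have "x = c *\<^sub>R (inverse c *\<^sub>R x)"
      using c by simp
    ultimately show "x \<in> (\<lambda>x. c *\<^sub>R x) ` (L \<inter> cball 0 r)"
      by blast
  qed
  moreover have "(\<lambda>x. c *\<^sub>R x) ` (L \<inter> cball 0 r) \<subseteq> L"
    using cn c by (auto simp: cone_def)
  \<comment> \<open>The dilated piece is too large when \<open>s < r\<close>, so it is cut back to
    radius \<open>s\<close>; a closed subset of a compact set remains compact.\<close>
  ultimately have "L \<inter> cball 0 s = (\<lambda>x. c *\<^sub>R x) ` (L \<inter> cball 0 r) \<inter> cball 0 s"
    by blast
  then show ?thesis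
    using compact_Int_closed[OF compact_scaling[OF r(2)] closed_cball] by metis
qed

text \<open>A finite subcover of \<open>K\<close> already covers a uniform neighbourhood of
  \<open>K\<close>, which contains all but finitely many \<open>x n\<close>. Arguing with covers of
  \<open>K \<union> range x\<close> itself means that no limit of \<open>x\<close> has to be
  produced.\<close>

lemma compact_Un_range_asymptotic:
  fixes x l :: "nat \<Rightarrow> 'a::real_normed_vector"
  assumes K: "compact K" and l: "\<And>n. l n \<in> K"
    and lim: "(\<lambda>n. norm (x n - l n)) \<longlonglongrightarrow> 0"
  shows "compact (K \<union> range x)"
proof (rule compactI)
  fix C :: "'a set set"
  assume op: "\<forall>U\<in>C. open U" and cov: "K \<union> range x \<subseteq> \<Union>C"
  obtain C1 where C1: "C1 \<subseteq> C" "finite C1" "K \<subseteq> \<Union>C1"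
    using compactE[OF K, of C] op cov by (metis Un_subset_iff)
  have "open (\<Union>C1)"
    using C1 op by blast
  then obtain e where e: "e > 0" "(\<Union>y\<in>K. ball y e) \<subseteq> \<Union>C1"
    using compact_subset_open_imp_ball_epsilon_subset[OF K _ C1(3)] by metis
  obtain N where N: "\<And>n. n \<ge> N \<Longrightarrow> norm (x n - l n) < e"
    using order_tendstoD(2)[OF lim e(1)] by (auto simp: eventually_sequentially)
  have tail: "x n \<in> \<Union>C1" if "n \<ge> N" for n
  proof -
    have "x n \<in> ball (l n) e"
      using N[OF that] by (simp add: dist_norm norm_minus_commute)
    then show ?thesis
      using l[of n] e(2) by blast
  qed
  have "\<forall>n. \<exists>V. V \<in> C \<and> x n \<in> V"
    using cov by blast
  then obtain U where U: "\<And>n. U n \<in> C \<and> x n \<in> U n"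
    by metis
  \<comment> \<open>One further member of the cover is spent on each of the finitely many
    \<open>x n\<close> with \<open>n < N\<close>.\<close>
  have "K \<subseteq> \<Union>(C1 \<union> U ` {..<N})"
    using C1 by blast
  moreover have "x n \<in> \<Union>(C1 \<union> U ` {..<N})" for n
    using tail[of n] U[of n] by (cases "n < N") auto
  ultimately have "K \<union> range x \<subseteq> \<Union>(C1 \<union> U ` {..<N})"
    by blast
  moreover have "C1 \<union> U ` {..<N} \<subseteq> C" "finite (C1 \<union> U ` {..<N})"
    using C1 U by auto
  ultimately show "\<exists>C'\<subseteq>C. finite C' \<and> K \<union> range x \<subseteq> \<Union>C'"
    by blast
qed

lemma relatively_compact_seqI:
  assumes "compact K" "range s \<subseteq> K"
  shows "relatively_compact_seq s"
  using assms unfolding relatively_compact_seq_def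
  by (metis closure_minimal closed_closure compact_imp_closed compact_Int_closed inf.absorb_iff2)

text \<open>If convergence failed, a subsequence would avoid some open \<open>U\<close> around
  \<open>p\<close>. It would lie in the compact set \<open>K - U\<close> and so yield a cluster
  point different from \<open>p\<close>.\<close>

lemma compact_unique_cluster_point_LIMSEQ:
  fixes s :: "nat \<Rightarrow> 'a::metric_space"
  assumes K: "compact K" "\<And>n. s n \<in> K"
    and uniq: "\<And>q. seq_cluster_point s q \<Longrightarrow> q = p"
  shows "s \<longlonglongrightarrow> p"
proof (rule topological_tendstoI, rule ccontr)
  fix U assume U: "open U" "p \<in> U" "\<not> eventually (\<lambda>n. s n \<in> U) sequentially"
  obtain r :: "nat \<Rightarrow> nat" where r: "strict_mono r" "\<And>n. s (r n) \<notin> U"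
    using not_eventually_sequentiallyD[OF U(3)] by metis
  have "compact (K - U)"
    using K U by (simp add: compact_diff)
  moreover have "\<forall>n. (s \<circ> r) n \<in> K - U"
    using K r by simp
  ultimately obtain q r' where q: "q \<in> K - U" "strict_mono r'" "((s \<circ> r) \<circ> r') \<longlonglongrightarrow> q"
    unfolding compact_def by metis
  have "seq_cluster_point s q"
    unfolding seq_cluster_point_def
    using q r strict_mono_o[of r r'] by (intro exI[of _ "r \<circ> r'"]) (simp add: o_assoc)
  then show False
    using uniq q U by blast
qed

text \<open>The null difference is subtracted along the same subsequence. This reduces optimality of
  the cluster points of \<open>x\<close> to that of the feasible sequence \<open>l\<close>.\<close>

lemma seq_cluster_point_asymptotic:
  fixes x l :: "nat \<Rightarrow> 'a::real_normed_vector"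
  assumes lim: "(\<lambda>n. norm (x n - l n)) \<longlonglongrightarrow> 0" and "seq_cluster_point x p"
  shows "seq_cluster_point l p"
proof -
  obtain r where r: "strict_mono r" "(x \<circ> r) \<longlonglongrightarrow> p"
    using assms by (auto simp: seq_cluster_point_def)
  have "(\<lambda>n. x (r n) - l (r n)) \<longlonglongrightarrow> 0"
    using LIMSEQ_subseq_LIMSEQ[OF lim r(1)] by (simp add: o_def tendsto_norm_zero_iff)
  then have "(l \<circ> r) \<longlonglongrightarrow> p"
    using tendsto_diff[OF r(2)] by (fastforce simp: o_def)
  then show ?thesis
    using r by (auto simp: seq_cluster_point_def)
qed

theorem corollary5p9:
  fixes L :: "'a::real_normed_vector set"
    and g :: "'a \<Rightarrow> real" and Lg M R :: real
    and \<eta> :: "nat \<Rightarrow> real"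
    and D :: "nat \<Rightarrow> 'a set" and \<Phi> :: "nat \<Rightarrow> 'a \<Rightarrow> real"
    and x :: "nat \<Rightarrow> 'a"
  assumes "locally_compact_cone L"
    and "Lg > 0" and "Lg-lipschitz_on UNIV g"
    and "\<And>n. 0 < \<eta> n \<and> \<eta> n < 1" and "decseq \<eta>" and "\<eta> \<longlonglongrightarrow> 0"
    and "\<And>n. admissible L g Lg (\<eta> n) (D n) (\<Phi> n)"
    and "M > Lg"
    and "\<And>n. x n \<in> argmin_on UNIV (penalized g M (\<Phi> n))"
    and "R > 0" and "\<And>n. norm (x n) \<le> R"
  shows "\<exists>l. (\<forall>n. l n \<in> L) \<and>
     (\<lambda>n. norm (x n - l n)) \<longlonglongrightarrow> 0 \<and>
     (\<lambda>n. ereal (g (l n))) \<longlonglongrightarrow> inf_val L g \<and>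
     (\<lambda>n. inf_val UNIV (penalized g M (\<Phi> n))) \<longlonglongrightarrow> inf_val L g \<and>
     relatively_compact_seq x \<and> relatively_compact_seq l \<and>
     argmin_on L g \<noteq> {} \<and>
     (\<forall>p. seq_cluster_point x p \<or> seq_cluster_point l p \<longrightarrow> p \<in> argmin_on L g) \<and>
     (\<forall>lbar. argmin_on L g = {lbar} \<longrightarrow> x \<longlonglongrightarrow> lbar \<and> l \<longlonglongrightarrow> lbar)"
proof -
  \<comment> \<open>Each estimate carries its own witness for the infimum over \<open>L\<close>,
    hence \<open>v\<close> may formally depend on \<open>n\<close>. The bounds in
    \<open>norm (x n)\<close> are chained to bounds that depend on \<open>n\<close> only through
    \<open>\<eta> n\<close>.\<close>
  have "\<exists>v w l. inf_val L g = ereal v \<and>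
      inf_val UNIV (penalized g M (\<Phi> n)) = ereal w \<and> l \<in> L \<and>
      norm (x n - l) \<le> R * \<eta> n \<and> 0 \<le> g l - v \<and> g l - v \<le> Lg * R * \<eta> n \<and>
      0 \<le> v - w \<and> v - w \<le> Lg * R * \<eta> n" for n
  proof -
    have "penalty_estimates L g Lg (\<eta> n) M (\<Phi> n)"
      using assms(7)[of n] \<open>M > Lg\<close> by (simp add: admissible_def)
    then show ?thesis
      using assms(9)[of n] assms(10) assms(11)[of n]
      unfolding penalty_estimates_def by (meson order_trans)
  qed
  then obtain v w l where
    "\<And>n. inf_val L g = ereal (v n)" and
    w: "\<And>n. inf_val UNIV (penalized g M (\<Phi> n)) = ereal (w n)" and
    lL: "\<And>n. l n \<in> L" and
    xl: "\<And>n. norm (x n - l n) \<le> R * \<eta> n" and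
    "\<And>n. 0 \<le> g (l n) - v n \<and> g (l n) - v n \<le> Lg * R * \<eta> n \<and>
      0 \<le> v n - w n \<and> v n - w n \<le> Lg * R * \<eta> n"
    by metis
  \<comment> \<open>All \<open>v n\<close> name the same extended real infimum, so they
    coincide.\<close>
  moreover from this(1) have "v n = v 0" for n
    by (metis ereal.inject)
  ultimately have v: "inf_val L g = ereal (v 0)" and
    est: "\<And>n. 0 \<le> g (l n) - v 0" "\<And>n. g (l n) - v 0 \<le> Lg * R * \<eta> n"
      "\<And>n. 0 \<le> v 0 - w n" "\<And>n. v 0 - w n \<le> Lg * R * \<eta> n"
    by metis+
  have R\<eta>: "(\<lambda>n. R * \<eta> n) \<longlonglongrightarrow> 0" and LR\<eta>: "(\<lambda>n. Lg * R * \<eta> n) \<longlonglongrightarrow> 0"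
    using tendsto_mult_right_zero[OF \<open>\<eta> \<longlonglongrightarrow> 0\<close>] by blast+
  have lim: "(\<lambda>n. norm (x n - l n)) \<longlonglongrightarrow> 0"
    by (rule tendsto_sandwich[OF _ _ tendsto_const R\<eta>]) (auto simp: xl)
  have "(\<lambda>n. g (l n) - v 0) \<longlonglongrightarrow> 0" "(\<lambda>n. v 0 - w n) \<longlonglongrightarrow> 0"
    by (rule tendsto_sandwich[OF _ _ tendsto_const LR\<eta>]; simp add: est del: diff_ge_0_iff_ge)+
  then have gl: "(\<lambda>n. g (l n)) \<longlonglongrightarrow> v 0" and wl: "w \<longlonglongrightarrow> v 0"
    using tendsto_diff[OF tendsto_const[of "v 0"], of "\<lambda>n. v 0 - w n" 0]
    by (auto simp: LIM_zero_iff)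
  \<comment> \<open>The radius comes from \<open>norm (l n) \<le> norm (x n) + norm (x n - l n)
    \<le> R + R * \<eta> n\<close> and \<open>\<eta> n < 1\<close>.\<close>
  define K where "K = L \<inter> cball 0 (2 * R)"
  have K: "compact K"
    unfolding K_def using assms(1) by (rule cone_inter_cball_compact)
  have lK: "l n \<in> K" for n
  proof -
    have "R * \<eta> n \<le> R"
      using assms(4)[of n] \<open>R > 0\<close> by simp
    then have "norm (l n) \<le> 2 * R"
      using norm_triangle_ineq4[of "x n" "x n - l n"] xl[of n] assms(11)[of n] by simp
    then show ?thesis
      using lL by (simp add: K_def)
  qed
  have clus: "p \<in> argmin_on L g" if p: "seq_cluster_point l p" for p
  proof -
    obtain r where r: "strict_mono r" "(l \<circ> r) \<longlonglongrightarrow> p"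
      using p by (auto simp: seq_cluster_point_def)
    have "p \<in> K"
      using closed_sequentially[OF compact_imp_closed[OF K] _ r(2)] lK by simp
    have "continuous_on UNIV g"
      using assms(3) by (rule lipschitz_on_continuous_on)
    then have "(\<lambda>n. g ((l \<circ> r) n)) \<longlonglongrightarrow> g p"
      by (rule continuous_on_tendsto_compose[OF _ r(2)]) auto
    moreover have "(\<lambda>n. g ((l \<circ> r) n)) \<longlonglongrightarrow> v 0"
      using LIMSEQ_subseq_LIMSEQ[OF gl r(1)] by (simp add: o_def)
    ultimately have "g p = v 0"
      by (rule LIMSEQ_unique)
    then show ?thesis
      using \<open>p \<in> K\<close> v by (simp add: argmin_on_def K_def)
  qed
  \<comment> \<open>Existence of a minimizer: sequential compactness of \<open>K\<close> gives
    \<open>l\<close> a cluster point, and every such point is optimal.\<close>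
  obtain p where "seq_cluster_point l p"
    using K lK unfolding compact_def seq_cluster_point_def by metis
  then have "argmin_on L g \<noteq> {}"
    using clus by blast
  moreover have "x \<longlonglongrightarrow> b \<and> l \<longlonglongrightarrow> b" if "argmin_on L g = {b}" for b
  proof
    show "l \<longlonglongrightarrow> b"
      using K lK by (rule compact_unique_cluster_point_LIMSEQ) (use clus that in blast)
    then show "x \<longlonglongrightarrow> b"
      using tendsto_add[of "\<lambda>n. x n - l n" 0 sequentially l b] lim
      by (simp add: tendsto_norm_zero_iff)
  qed
  moreover have "relatively_compact_seq x"
    using compact_Un_range_asymptotic[OF K lK lim] by (rule relatively_compact_seqI) simp
  moreover have "relatively_compact_seq l"
    using K by (rule relatively_compact_seqI) (use lK in blast)
  ultimately show ?thesis
    using lL lim gl wl clus seq_cluster_point_asymptotic[OF lim]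
    by (intro exI[of _ l]) (auto simp: v w)
qed

end
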